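(* Let $\xi=(\xi_1,\dots,\xi_p)^\top$ be a partition of unity, and let $M$ be a $p\times p$ doubly stochastic matrix. Then the function defined for all $(u,v)\in[0,1]^2$ by $c(u,v)=p\,\xi(u)^\top M\,\xi(v)$ is a density of copula and $c\in\mathcal{C}_\phi$. Moreover, $$\phi=(H\Gamma_\xi H^\top)^{-1/2}H\xi,$$ where $s=e_1+\dots+e_p$, $H=I_p+e_1s^\top-s\,e_1^\top$, and $\Gamma_\xi$ is the Gram matrix associated to $\xi$.
   Context: Here $p\ge 2$, $e_1,\dots,e_p$ is the canonical basis of $\mathbb{R}^p$, and $I_p$ is the $p\times p$ identity matrix. A partition of unity is a collection of functions $\xi_1,\dots,\xi_p$ on $[0,1]$ such that $\xi_i\ge 0$ for all $i=1,\dots,p$, $\int_0^1\xi_i(x)\,dx=1/p$ for all $i=1,\dots,p$, and $\sum_{i=1}^p\xi_i=1$. Its Gram matrix is $\Gamma_\xi=\int_0^1\xi(x)\,\xi(x)^\top dx\in\mathbb{R}^{p\times p}$. The notation $S^{-1/2}$ denotes the inverse square root of the symmetric matrix $S$. A doubly stochastic matrix has nonnegative entries with all row sums and all column sums equal to $1$. For a vector $\phi=(\phi_1,\dots,\phi_p)^\top:[0,1]\to\mathbb{R}^p$ of $p$ functions that are orthonormal in $L_2([0,1])$ (usual scalar product $\langle f,g\rangle=\int_0^1 f(t)g(t)\,dt$) and such that $\phi_1(t)=1$ for all $t\in[0,1]$, define $$\mathcal{A}_\phi=\{A\in\mathbb{R}^{p\times p}:\ Ae_1=e_1,\ A^\top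 e_1=e_1,\ \phi(u)^\top A\,\phi(v)\ge 0\ \text{ for all } (u,v)\in[0,1]^2\},$$ $$\mathcal{C}_\phi=\{c:[0,1]^2\to\mathbb{R}:\ c(u,v)=\phi(u)^\top A\,\phi(v),\ A\in\mathcal{A}_\phi\}.$$ A bivariate copula is a bivariate cumulative distribution function on $[0,1]^2$ with uniform margins on $[0,1]$; a density of copula is the density of such a distribution.
   Formalization: The claims about φ (its formula and c ∈ C_φ) are stated for invertible HΓ_ξH^T, since otherwise (e.g. all ξ_i = 1/p) the inverse square root does not exist; that c is a density of copula is stated without this condition. *)

theory Defs
  imports "HOL-Analysis.Analysis" "HOL-Probability.Probability_Measure"
begin

text \<open>
  The index set \<open>{1, \<dots>, p}\<close> is a finite type \<open>'p\<close> with \<open>CARD('p) = p\<close>. No order on it is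
  needed: where the first basis vector \<open>e\<^sub>1\<close> plays a role, an element \<open>i1\<close> of \<open>'p\<close> is passed
  as the label of the first coordinate. Functions on \<open>[0,1]\<close> are functions on \<open>real\<close> that are
  constrained and integrated over \<open>{0..1}\<close> only.
\<close>

abbreviation unit_interval_measure :: "real measure" where
  "unit_interval_measure \<equiv> lebesgue_on {0..1}"

definition partition_of_unity :: "(real \<Rightarrow> real^'p) \<Rightarrow> bool" where
  "partition_of_unity \<xi> \<longleftrightarrow>
     (\<forall>i. \<forall>x\<in>{0..1}. 0 \<le> \<xi> x $ i) \<and>
     (\<forall>i. integrable unit_interval_measure (\<lambda>x. \<xi> x $ i)) \<and>
     (\<forall>i. (LINT x|unit_interval_measure. \<xi> x $ i) = 1 / real CARD('p)) \<and>
     (\<forall>x\<in>{0..1}. (\<Sum>i\<in>UNIV. \<xi> x $ i) = 1)"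

definition gram_matrix :: "(real \<Rightarrow> real^'p) \<Rightarrow> real^'p^'p" where
  "gram_matrix \<xi> = (\<chi> i j. LINT x|unit_interval_measure. \<xi> x $ i * \<xi> x $ j)"

definition doubly_stochastic :: "real^'p^'p \<Rightarrow> bool" where
  "doubly_stochastic M \<longleftrightarrow>
     (\<forall>i j. 0 \<le> M $ i $ j) \<and>
     (\<forall>i. (\<Sum>j\<in>UNIV. M $ i $ j) = 1) \<and>
     (\<forall>j. (\<Sum>i\<in>UNIV. M $ i $ j) = 1)"

definition orthonormal_L2 :: "(real \<Rightarrow> real^'p) \<Rightarrow> bool" where
  "orthonormal_L2 \<phi> \<longleftrightarrow>
     (\<forall>i. (\<lambda>t. \<phi> t $ i) \<in> borel_measurable unit_interval_measure) \<and>
     (\<forall>i. integrable unit_interval_measure (\<lambda>t. (\<phi> t $ i)\<^sup>2)) \<and>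
     (\<forall>i j. (LINT t|unit_interval_measure. \<phi> t $ i * \<phi> t $ j) = (if i = j then 1 else 0))"

definition A_set :: "'p \<Rightarrow> (real \<Rightarrow> real^'p) \<Rightarrow> (real^'p^'p) set" where
  "A_set i1 \<phi> = {A. A *v axis i1 1 = axis i1 1 \<and> transpose A *v axis i1 1 = axis i1 1 \<and>
                     (\<forall>u\<in>{0..1}. \<forall>v\<in>{0..1}. 0 \<le> \<phi> u \<bullet> (A *v \<phi> v))}"

definition C_set :: "'p \<Rightarrow> (real \<Rightarrow> real^'p) \<Rightarrow> (real \<Rightarrow> real \<Rightarrow> real) set" where
  "C_set i1 \<phi> = {c. \<exists>A\<in>A_set i1 \<phi>. \<forall>u\<in>{0..1}. \<forall>v\<in>{0..1}. c u v = \<phi> u \<bullet> (A *v \<phi> v)}"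

text \<open>
  The probability laws on the plane whose cumulative distribution functions are the bivariate
  copulas, i.e. those with both margins uniform on \<open>[0,1]\<close>.
\<close>

definition copula_law :: "(real \<times> real) measure \<Rightarrow> bool" where
  "copula_law \<mu> \<longleftrightarrow> prob_space \<mu> \<and> sets \<mu> = sets borel \<and>
     distr \<mu> borel fst = uniform_measure lborel {0..1} \<and>
     distr \<mu> borel snd = uniform_measure lborel {0..1}"

text \<open>
  A density is allowed to be merely Lebesgue measurable, hence the law is compared with the
  integral of \<open>c\<close> on Borel sets rather than by an equation between measures.
\<close>

definition copula_density :: "(real \<Rightarrow> real \<Rightarrow> real) \<Rightarrow> bool" where
  "copula_density c \<longleftrightarrow>
     (\<forall>u\<in>{0..1}. \<forall>v\<in>{0..1}. 0 \<le> c u v) \<and>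
     (\<lambda>z. c (fst z) (snd z)) \<in> borel_measurable (lebesgue_on ({0..1} \<times> {0..1})) \<and>
     (\<exists>\<mu>. copula_law \<mu> \<and>
       (\<forall>B\<in>sets borel. emeasure \<mu> B =
          (\<integral>\<^sup>+z\<in>B. ennreal (c (fst z) (snd z)) \<partial>lebesgue_on ({0..1} \<times> {0..1}))))"

definition pos_def :: "real^'p^'p \<Rightarrow> bool" where
  "pos_def S \<longleftrightarrow> transpose S = S \<and> (\<forall>x. x \<noteq> 0 \<longrightarrow> 0 < x \<bullet> (S *v x))"

text \<open>
  \<open>S\<^sup>-\<^sup>1\<^sup>/\<^sup>2\<close>: the symmetric positive definite square root of \<open>S\<^sup>-\<^sup>1\<close>. It exists and is unique when
  \<open>S\<close> is symmetric positive definite, and is meaningful only in that case.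
\<close>

definition inv_sqrt :: "real^'p^'p \<Rightarrow> real^'p^'p" where
  "inv_sqrt S = (THE R. pos_def R \<and> R ** R = matrix_inv S)"

definition outer :: "real^'p \<Rightarrow> real^'p \<Rightarrow> real^'p^'p" where
  "outer x y = (\<chi> i j. x $ i * y $ j)"

definition s_vec :: "real^'p" where
  "s_vec = (\<Sum>i\<in>UNIV. axis i 1)"

definition H_mat :: "'p \<Rightarrow> real^'p^'p" where
  "H_mat i1 = mat 1 + outer (axis i1 1) s_vec - outer s_vec (axis i1 1)"

end

theory Submission
  imports Defs
begin

text \<open>
  The whole proposition rests on the two ways in which the all-ones vector \<open>s\<close> is distinguished.
  It is fixed by \<open>M\<close> and by \<open>M\<^sup>T\<close>, and \<open>s \<bullet> \<xi> = 1\<close>, so that \<open>\<Gamma> s = s / p\<close> for the Gram matrix \<open>\<Gamma>\<close>.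

  For the copula, integrating \<open>c(u,v) = p \<Sum> M\<^sub>i\<^sub>j \<xi>\<^sub>i(u) \<xi>\<^sub>j(v)\<close> over \<open>v\<close> leaves \<open>\<Sum> M\<^sub>i\<^sub>j \<xi>\<^sub>i(u) = 1\<close>,
  and likewise for \<open>u\<close>. The work, in \<open>copula_density_of_partition\<close>, is to make this a statement about
  Borel laws although the \<open>\<xi>\<^sub>i\<close> are only Lebesgue measurable.

  For the basis \<open>\<phi>\<close>, put \<open>L = S\<^sup>-\<^sup>1\<^sup>/\<^sup>2 H\<close> with \<open>S = H \<Gamma> H\<^sup>T\<close>, so that \<open>\<phi> = L \<xi>\<close> has Gram matrix
  \<open>L \<Gamma> L\<^sup>T = S\<^sup>-\<^sup>1\<^sup>/\<^sup>2 S S\<^sup>-\<^sup>1\<^sup>/\<^sup>2 = I\<close>. The matrix \<open>H\<close> is designed such that \<open>H s = p e\<^sub>1\<close> and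
  \<open>H\<^sup>T e\<^sub>1 = s\<close>. These give \<open>S e\<^sub>1 = e\<^sub>1\<close>, hence \<open>S\<^sup>-\<^sup>1\<^sup>/\<^sup>2 e\<^sub>1 = e\<^sub>1\<close>, hence the same two identities for
  \<open>L\<close> (\<open>whitened_partition_of_unity\<close>). The second one says that \<open>\<phi>\<close> has first coordinate
  \<open>s \<bullet> \<xi> = 1\<close>; together they show that \<open>A = p L\<^sup>-\<^sup>T M L\<^sup>-\<^sup>1\<close>, the matrix for which
  \<open>\<phi>(u) \<bullet> A \<phi>(v) = c(u,v)\<close>, satisfies \<open>A e\<^sub>1 = e\<^sub>1\<close> and \<open>A\<^sup>T e\<^sub>1 = e\<^sub>1\<close> (\<open>form_in_C_set\<close>).

  That \<open>S\<^sup>-\<^sup>1\<^sup>/\<^sup>2\<close> is well defined amounts to existence and uniqueness of positive definite square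
  roots. Both follow from the spectral theorem for self-adjoint maps
  (\<open>self_adjoint_eigenbasis\<close>).
\<close>

section \<open>Square roots of positive definite matrices\<close>

text \<open>
  The parabola \<open>t \<mapsto> (y + t x) \<bullet> f (y + t x)\<close> has no quadratic term, so if its linear coefficient
  \<open>2 (y \<bullet> f x)\<close> did not vanish it would take negative values. This replaces the Cauchy-Schwarz
  inequality for the semi-inner product \<open>x \<bullet> f y\<close>, and serves twice: a maximiser of the Rayleigh
  quotient is an eigenvector, and an invertible positive semidefinite matrix is positive definite.
\<close>

lemma nonneg_form_null_vector:
  fixes f :: "'a::real_inner \<Rightarrow> 'a"
  assumes lin: "linear f" and sym: "\<And>x y. f x \<bullet> y = x \<bullet> f y" and V: "subspace V"
    and nonneg: "\<And>y. y \<in> V \<Longrightarrow> 0 \<le> y \<bullet> f y"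
    and x: "x \<in> V" "x \<bullet> f x = 0" and y: "y \<in> V"
  shows "y \<bullet> f x = 0"
proof (rule ccontr)
  assume b: "y \<bullet> f x \<noteq> 0"
  \<comment> \<open>at this \<open>t\<close> the parabola has the value \<open>-1\<close>\<close>
  define t where "t = - (y \<bullet> f y + 1) / (2 * (y \<bullet> f x))"
  have "x \<bullet> f y = y \<bullet> f x"
    by (metis sym inner_commute)
  then have "(y + t *\<^sub>R x) \<bullet> f (y + t *\<^sub>R x) = y \<bullet> f y + 2 * t * (y \<bullet> f x)"
    using x(2) by (simp add: linear_add[OF lin] linear_cmul[OF lin] inner_add_left inner_add_right)
  also have "\<dots> = -1"
    using b by (simp add: t_def field_simps)
  finally show False
    using nonneg[of "y + t *\<^sub>R x"] V x y by (auto simp: subspace_add subspace_scale)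
qed

text \<open>
  The Rayleigh quotient attains a maximum \<open>l\<close> at some \<open>x\<close> on the unit sphere of \<open>V\<close>. The form of
  \<open>g = l I - f\<close> is then nonnegative on \<open>V\<close> and vanishes at \<open>x\<close>, hence \<open>g x\<close> is orthogonal to \<open>V\<close>;
  but \<open>g x\<close> lies in \<open>V\<close>.
\<close>

lemma self_adjoint_unit_eigenvector:
  fixes f :: "'a::euclidean_space \<Rightarrow> 'a"
  assumes lin: "linear f" and sym: "\<And>x y. f x \<bullet> y = x \<bullet> f y"
    and V: "subspace V" "f ` V \<subseteq> V" "V \<noteq> {0}"
  obtains x l where "x \<in> V" "norm x = 1" "f x = l *\<^sub>R x"
proof -
  let ?U = "sphere 0 1 \<inter> V"
  obtain v where v: "v \<in> V" "v \<noteq> 0"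
    using V subspace_0 by blast
  then have "(1 / norm v) *\<^sub>R v \<in> ?U"
    using V by (simp add: subspace_scale)
  moreover have "compact ?U"
    using V by (intro compact_Int_closed) (auto simp: closed_subspace)
  moreover have "continuous_on ?U (\<lambda>x. x \<bullet> f x)"
    using lin by (intro continuous_intros linear_continuous_on) (simp add: linear_linear)
  ultimately obtain x where x: "x \<in> ?U" and sup: "\<And>y. y \<in> ?U \<Longrightarrow> y \<bullet> f y \<le> x \<bullet> f x"
    using continuous_attains_sup[of ?U "\<lambda>x. x \<bullet> f x"] by blast
  define l where "l = x \<bullet> f x"
  define g where "g = (\<lambda>y. l *\<^sub>R y - f y)"
  have xx: "x \<bullet> x = 1"
    using x by (simp add: dot_square_norm)
  have nonneg: "0 \<le> y \<bullet> g y" if y: "y \<in> V" for y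
  proof (cases "y = 0")
    case False
    then have "(1 / norm y) *\<^sub>R y \<in> ?U"
      using V y by (simp add: subspace_scale)
    from sup[OF this] have "(y \<bullet> f y) / (norm y * norm y) \<le> l"
      by (simp add: linear_cmul[OF lin] l_def)
    then have "y \<bullet> f y \<le> l * (y \<bullet> y)"
      using False by (simp add: divide_simps dot_square_norm power2_eq_square)
    then show ?thesis
      by (simp add: g_def inner_diff_right)
  qed simp
  have lin_g: "linear g"
    using lin unfolding g_def by (intro linear_compose_sub linear_scale_self) auto
  have sym_g: "g a \<bullet> b = a \<bullet> g b" for a b
    by (simp add: g_def inner_diff_left inner_diff_right sym)
  have "g x \<in> V"
    using V x unfolding g_def by (auto simp: subspace_diff subspace_scale)
  moreover have "x \<bullet> g x = 0"
    using xx by (simp add: g_def inner_diff_right l_def)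
  ultimately have "g x \<bullet> g x = 0"
    using x by (simp add: nonneg_form_null_vector[OF lin_g sym_g V(1) nonneg])
  then have "f x = l *\<^sub>R x"
    by (simp add: g_def)
  then show thesis
    using that x by auto
qed

text \<open>
  The spectral theorem, by splitting off one eigenvector \<open>x\<close> at a time: self-adjointness makes the
  orthogonal complement of \<open>x\<close> in \<open>V\<close> invariant, and it has smaller dimension. That \<open>B\<close> is a basis
  is expressed by the expansion of every \<open>v\<close>, the form in which it is used.
\<close>

lemma self_adjoint_eigenbasis:
  fixes f :: "'a::euclidean_space \<Rightarrow> 'a"
  assumes lin: "linear f" and sym: "\<And>x y. f x \<bullet> y = x \<bullet> f y"
    and "subspace V" "f ` V \<subseteq> V"
  shows "\<exists>B. finite B \<and> (\<forall>a\<in>B. \<forall>b\<in>B. a \<bullet> b = (if a = b then 1 else 0)) \<and>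
    B \<subseteq> V \<and> (\<forall>b\<in>B. \<exists>l. f b = l *\<^sub>R b) \<and> (\<forall>v\<in>V. (\<Sum>b\<in>B. (v \<bullet> b) *\<^sub>R b) = v)"
  using assms(3,4)
proof (induction "dim V" arbitrary: V rule: less_induct)
  case less
  show ?case
  proof (cases "V = {0}")
    case True
    then show ?thesis by (intro exI[of _ "{}"]) auto
  next
    case False
    obtain x l where x: "x \<in> V" "norm x = 1" "f x = l *\<^sub>R x"
      using self_adjoint_unit_eigenvector[OF lin sym less.prems False] by blast
    then have xx: "x \<bullet> x = 1"
      by (simp add: dot_square_norm)
    define W where "W = {y \<in> V. x \<bullet> y = 0}"
    have W: "subspace W"
      using less.prems(1) unfolding W_def subspace_def by (auto simp: inner_add_right)
    have "f ` W \<subseteq> W"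
      using less.prems(2) x(3) by (auto simp: W_def simp flip: sym)
    moreover have "W \<subset> V"
      using x(1) xx unfolding W_def by force
    then have "dim W < dim V"
      using W less.prems(1) by (intro dim_psubset) (simp add: span_eq_iff[THEN iffD2])
    ultimately obtain B where B: "finite B" "\<forall>a\<in>B. \<forall>b\<in>B. a \<bullet> b = (if a = b then 1 else 0)"
      "B \<subseteq> W" "\<forall>b\<in>B. \<exists>l. f b = l *\<^sub>R b" "\<And>w. w \<in> W \<Longrightarrow> (\<Sum>b\<in>B. (w \<bullet> b) *\<^sub>R b) = w"
      using less.hyps[OF _ W] by blast
    have xB: "x \<bullet> b = 0" "b \<bullet> x = 0" if "b \<in> B" for b
      using B(3) that by (auto simp: W_def inner_commute)
    then have "x \<notin> B"
      using xx by force
    have "(\<Sum>b\<in>insert x B. (v \<bullet> b) *\<^sub>R b) = v" if v: "v \<in> V" for v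
    proof -
      define w where "w = v - (v \<bullet> x) *\<^sub>R x"
      have "w \<in> W"
        using v x xx less.prems(1)
        by (auto simp: W_def w_def subspace_diff subspace_scale inner_diff_right inner_commute)
      then have "w = (\<Sum>b\<in>B. (w \<bullet> b) *\<^sub>R b)"
        by (simp add: B(5))
      also have "\<dots> = (\<Sum>b\<in>B. (v \<bullet> b) *\<^sub>R b)"
        by (intro sum.cong) (auto simp: w_def inner_diff_left xB)
      finally show ?thesis
        using B(1) \<open>x \<notin> B\<close> by (simp add: w_def algebra_simps)
    qed
    then show ?thesis
      using B x xx xB \<open>x \<notin> B\<close> by (intro exI[of _ "insert x B"]) (auto simp: W_def)
  qed
qed

lemma symmetric_matrix_self_adjoint:
  fixes A :: "real^'n^'n"
  assumes "transpose A = A"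
  shows "(A *v x) \<bullet> y = x \<bullet> (A *v y)"
  by (metis assms dot_lmul_matrix transpose_matrix_vector)

lemma self_adjoint_matrix_symmetric:
  fixes A :: "real^'n^'n"
  assumes "\<And>x y. (A *v x) \<bullet> y = x \<bullet> (A *v y)"
  shows "transpose A = A"
proof -
  have "(transpose A *v x - A *v x) \<bullet> y = 0" for x y
    by (simp add: inner_diff_left assms dot_lmul_matrix)
  then have "transpose A *v x = A *v x" for x
    by (metis eq_iff_diff_eq_0 inner_eq_zero_iff)
  then show ?thesis
    by (simp add: matrix_eq)
qed

lemma symmetric_matrix_eigenbasis:
  fixes A :: "real^'n^'n"
  assumes "transpose A = A"
  obtains B where "finite B" "\<And>a b. a \<in> B \<Longrightarrow> b \<in> B \<Longrightarrow> a \<bullet> b = (if a = b then 1 else 0)"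
    "\<And>b. b \<in> B \<Longrightarrow> \<exists>l. A *v b = l *\<^sub>R b" "\<And>x. (\<Sum>b\<in>B. (x \<bullet> b) *\<^sub>R b) = x"
proof -
  note self_adjoint_eigenbasis[OF matrix_vector_mul_linear[of A] symmetric_matrix_self_adjoint[OF assms]
      subspace_UNIV subset_UNIV]
  then obtain B where B: "finite B" "\<forall>a\<in>B. \<forall>b\<in>B. a \<bullet> b = (if a = b then 1 else 0)"
    "\<forall>b\<in>B. \<exists>l. A *v b = l *\<^sub>R b" "\<forall>x\<in>UNIV. (\<Sum>b\<in>B. (x \<bullet> b) *\<^sub>R b) = x"
    by (elim exE conjE)
  show thesis
  proof (rule that[OF B(1)])
    show "a \<bullet> b = (if a = b then 1 else 0)" if "a \<in> B" "b \<in> B" for a b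
      using B(2) that by blast
    show "\<exists>l. A *v b = l *\<^sub>R b" if "b \<in> B" for b
      using B(3) that by blast
    show "(\<Sum>b\<in>B. (x \<bullet> b) *\<^sub>R b) = x" for x
      using B(4) by blast
  qed
qed

text \<open>
  On an orthonormal eigenbasis the square root multiplies each \<open>b\<close> by the square root of its
  eigenvalue \<open>b \<bullet> (T *v b)\<close>.
\<close>

lemma pos_def_sqrt_exists:
  fixes T :: "real^'n^'n"
  assumes T: "pos_def T"
  shows "\<exists>R. pos_def R \<and> R ** R = T"
proof -
  obtain B where B: "finite B" "\<And>a b. a \<in> B \<Longrightarrow> b \<in> B \<Longrightarrow> a \<bullet> b = (if a = b then 1 else 0)"
    "\<And>b. b \<in> B \<Longrightarrow> \<exists>l. T *v b = l *\<^sub>R b" "\<And>x. (\<Sum>b\<in>B. (x \<bullet> b) *\<^sub>R b) = x"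
    using T symmetric_matrix_eigenbasis[of T] unfolding pos_def_def by blast
  define l where "l = (\<lambda>b. b \<bullet> (T *v b))"
  have eig: "T *v b = l b *\<^sub>R b" if "b \<in> B" for b
    using B(2,3) that unfolding l_def by force
  have l: "0 < l b" if "b \<in> B" for b
  proof -
    have "b \<noteq> 0"
      using B(2)[OF that that] by auto
    then show ?thesis
      using T by (simp add: l_def pos_def_def)
  qed
  define r where "r x = (\<Sum>b\<in>B. (sqrt (l b) * (x \<bullet> b)) *\<^sub>R b)" for x
  have lin: "linear r"
    by (rule linearI)
      (simp_all add: r_def inner_add_left algebra_simps sum.distrib scaleR_sum_right)
  have r: "matrix r *v x = r x" for x
    by (simp add: matrix_works lin)
  have r_inner: "y \<bullet> r x = (\<Sum>b\<in>B. sqrt (l b) * (x \<bullet> b) * (y \<bullet> b))" for x y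
    unfolding r_def by (simp add: inner_sum_right)
  have r_coord: "r x \<bullet> b = sqrt (l b) * (x \<bullet> b)" if b: "b \<in> B" for x b
  proof -
    have "r x \<bullet> b = (\<Sum>a\<in>B. if b = a then sqrt (l a) * (x \<bullet> a) else 0)"
      unfolding r_def inner_sum_left using B(2) b by (intro sum.cong) auto
    then show ?thesis
      using B(1) b by (simp add: sum.delta)
  qed
  have "transpose (matrix r) = matrix r"
    by (intro self_adjoint_matrix_symmetric)
      (simp add: r inner_commute[of "r _"] r_inner mult_ac)
  moreover have "0 < x \<bullet> (matrix r *v x)" if x: "x \<noteq> 0" for x
  proof -
    obtain b where "b \<in> B" "x \<bullet> b \<noteq> 0"
    proof (rule ccontr)
      assume "\<not> thesis"
      then have "(\<Sum>b\<in>B. (x \<bullet> b) *\<^sub>R b) = 0"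
        using that by (intro sum.neutral) auto
      then show False
        using B(4)[of x] x by simp
    qed
    moreover have "0 \<le> sqrt (l a) * (x \<bullet> a) * (x \<bullet> a)" if "a \<in> B" for a
      using l[OF that] by (simp add: mult.assoc)
    moreover have "0 < sqrt (l b) * (x \<bullet> b) * (x \<bullet> b)"
      using l calculation(1,2) by (simp add: mult.assoc zero_less_mult_iff) linarith
    ultimately show ?thesis
      unfolding r r_inner using B(1) by (intro sum_pos2[of B b]) auto
  qed
  moreover have "r (r x) = T *v x" for x
  proof -
    have "r (r x) = (\<Sum>b\<in>B. (sqrt (l b) * (r x \<bullet> b)) *\<^sub>R b)"
      unfolding r_def[of "r x"] ..
    also have "\<dots> = (\<Sum>b\<in>B. T *v ((x \<bullet> b) *\<^sub>R b))"
      using l by (intro sum.cong)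
        (auto simp: r_coord eig matrix_vector_mult_scaleR less_imp_le simp flip: mult.assoc)
    also have "\<dots> = T *v (\<Sum>b\<in>B. (x \<bullet> b) *\<^sub>R b)"
      by (simp add: linear_sum)
    finally show ?thesis
      using B(4)[of x] by simp
  qed
  then have "matrix r ** matrix r = T"
    by (simp add: matrix_eq r flip: matrix_vector_mul_assoc)
  ultimately show ?thesis
    unfolding pos_def_def by blast
qed

text \<open>
  If \<open>P\<^sup>2 = Q\<^sup>2\<close> then \<open>P (P - Q) + (P - Q) Q = 0\<close>. Evaluating this at an eigenvector \<open>b\<close> of the
  symmetric matrix \<open>P - Q\<close> with eigenvalue \<open>l\<close> gives \<open>l (b \<bullet> P b + b \<bullet> Q b) = 0\<close>, so \<open>l = 0\<close>:
  all eigenvalues of \<open>P - Q\<close> vanish.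
\<close>

lemma pos_def_sqrt_unique:
  fixes P Q :: "real^'n^'n"
  assumes P: "pos_def P" and Q: "pos_def Q" and eq: "P ** P = Q ** Q"
  shows "P = Q"
proof -
  have symP: "transpose P = P" and symQ: "transpose Q = Q"
    using P Q by (auto simp: pos_def_def)
  have symD: "transpose (P - Q) = P - Q"
    using symP symQ by (simp add: transpose_def vec_eq_iff)
  obtain B where B: "finite B" "\<And>a b. a \<in> B \<Longrightarrow> b \<in> B \<Longrightarrow> a \<bullet> b = (if a = b then 1 else 0)"
    "\<And>b. b \<in> B \<Longrightarrow> \<exists>l. (P - Q) *v b = l *\<^sub>R b" "\<And>x. (\<Sum>b\<in>B. (x \<bullet> b) *\<^sub>R b) = x"
    using symmetric_matrix_eigenbasis[OF symD] by blast
  have "(P - Q) *v b = 0" if b: "b \<in> B" for b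
  proof -
    obtain l where l: "(P - Q) *v b = l *\<^sub>R b"
      using B(3) b by blast
    have b0: "b \<noteq> 0"
      using B(2)[OF b b] by auto
    have "P *v (P *v b) = Q *v (Q *v b)"
      using eq by (simp add: matrix_vector_mul_assoc)
    then have "P *v ((P - Q) *v b) + (P - Q) *v (Q *v b) = 0"
      by (simp add: matrix_vector_mult_diff_distrib matrix_vector_mult_diff_rdistrib)
    then have "b \<bullet> (P *v ((P - Q) *v b)) + b \<bullet> ((P - Q) *v (Q *v b)) = 0"
      by (metis inner_add_right inner_zero_right)
    moreover have "b \<bullet> ((P - Q) *v (Q *v b)) = l * (b \<bullet> (Q *v b))"
      using l symmetric_matrix_self_adjoint[OF symD, of b "Q *v b"]
      by simp
    ultimately have "l * (b \<bullet> (P *v b) + b \<bullet> (Q *v b)) = 0"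
      by (simp add: l matrix_vector_mult_scaleR distrib_left)
    moreover have "0 < b \<bullet> (P *v b) + b \<bullet> (Q *v b)"
      using P Q b0 unfolding pos_def_def by (simp add: add_pos_pos)
    ultimately show ?thesis
      using l by auto
  qed
  then have "(P - Q) *v (\<Sum>b\<in>B. (x \<bullet> b) *\<^sub>R b) = 0" for x
    by (simp add: linear_sum matrix_vector_mult_scaleR)
  then have "(P - Q) *v x = 0" for x
    by (simp only: B(4))
  then show ?thesis
    by (simp add: matrix_eq matrix_vector_mult_diff_rdistrib)
qed

lemma matrix_inv_mult:
  fixes A :: "real^'n^'n"
  assumes "invertible A"
  shows "A ** matrix_inv A = mat 1" "matrix_inv A ** A = mat 1"
  using assms unfolding invertible_def matrix_inv_def by (metis (mono_tags, lifting) someI_ex)+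

lemma pos_def_matrix_inv:
  fixes S :: "real^'n^'n"
  assumes S: "pos_def S" and inv: "invertible S"
  shows "pos_def (matrix_inv S)"
proof -
  have cancel: "S *v (matrix_inv S *v x) = x" for x
    using matrix_inv_mult[OF inv] by (simp add: matrix_vector_mul_assoc)
  have S_sym: "(S *v x) \<bullet> y = x \<bullet> (S *v y)" for x y
    using S by (intro symmetric_matrix_self_adjoint) (simp add: pos_def_def)
  have "(matrix_inv S *v x) \<bullet> y = x \<bullet> (matrix_inv S *v y)" for x y
    by (metis cancel S_sym)
  moreover have "0 < x \<bullet> (matrix_inv S *v x)" if "x \<noteq> 0" for x
  proof -
    have "matrix_inv S *v x \<noteq> 0"
      using cancel[of x] that by auto
    then have "0 < (matrix_inv S *v x) \<bullet> (S *v (matrix_inv S *v x))"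
      using S by (simp add: pos_def_def)
    then show ?thesis
      by (simp add: cancel inner_commute)
  qed
  ultimately show ?thesis
    unfolding pos_def_def by (auto intro: self_adjoint_matrix_symmetric)
qed

lemma inv_sqrt_square:
  fixes S :: "real^'n^'n"
  assumes "pos_def S" "invertible S"
  shows "pos_def (inv_sqrt S)" "inv_sqrt S ** inv_sqrt S = matrix_inv S"
proof -
  have "\<exists>!R. pos_def R \<and> R ** R = matrix_inv S"
    using pos_def_sqrt_exists[OF pos_def_matrix_inv[OF assms]] pos_def_sqrt_unique by metis
  from theI'[OF this, folded inv_sqrt_def]
  show "pos_def (inv_sqrt S)" "inv_sqrt S ** inv_sqrt S = matrix_inv S"
    by auto
qed

lemma pos_semidef_invertible_pos_def:
  fixes S :: "real^'n^'n"
  assumes sym: "transpose S = S" and nonneg: "\<And>x. 0 \<le> x \<bullet> (S *v x)" and inv: "invertible S"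
  shows "pos_def S"
proof -
  have "x = 0" if "x \<bullet> (S *v x) = 0" for x
  proof -
    have "(S *v x) \<bullet> (S *v x) = 0"
      by (rule nonneg_form_null_vector[where f = "(*v) S" and V = UNIV])
        (use nonneg that symmetric_matrix_self_adjoint[OF sym] in auto)
    then have "matrix_inv S *v (S *v x) = 0"
      by simp
    then show "x = 0"
      using matrix_inv_mult[OF inv] by (simp add: matrix_vector_mul_assoc)
  qed
  then show ?thesis
    using sym nonneg unfolding pos_def_def by (metis order_le_less)
qed

text \<open>
  From \<open>R R = S\<^sup>-\<^sup>1\<close> the matrix \<open>R S\<close> is a right inverse of \<open>R\<close>, and a one-sided inverse of a square
  matrix is two-sided.
\<close>

lemma inv_sqrt_whitens:
  fixes S :: "real^'n^'n"
  assumes S: "pos_def S" "invertible S"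
  shows "inv_sqrt S ** S ** inv_sqrt S = mat 1"
proof -
  have "inv_sqrt S ** (inv_sqrt S ** S) = mat 1"
    by (simp add: matrix_mul_assoc inv_sqrt_square[OF S] matrix_inv_mult[OF S(2)])
  then show ?thesis
    by (simp add: matrix_left_right_inverse)
qed

text \<open>
  With \<open>y = R x - x\<close> the hypothesis gives \<open>R y = R\<^sup>2 x - R x = - y\<close>, and a positive definite \<open>R\<close>
  has no eigenvalue \<open>-1\<close>.
\<close>

lemma inv_sqrt_fixes:
  fixes S :: "real^'n^'n"
  assumes S: "pos_def S" "invertible S" and x: "S *v x = x"
  shows "inv_sqrt S *v x = x"
proof -
  let ?R = "inv_sqrt S"
  define y where "y = ?R *v x - x"
  have "matrix_inv S *v x = x"
    by (metis x matrix_inv_mult(2)[OF S(2)] matrix_vector_mul_assoc matrix_vector_mul_lid)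
  then have "?R *v (?R *v x) = x"
    by (simp add: matrix_vector_mul_assoc inv_sqrt_square[OF S])
  then have "?R *v y = - y"
    by (simp add: y_def matrix_vector_mult_diff_distrib)
  then have "y \<bullet> (?R *v y) \<le> 0"
    by simp
  then have "y = 0"
    using inv_sqrt_square(1)[OF S] unfolding pos_def_def by force
  then show ?thesis
    by (simp add: y_def)
qed

section \<open>Gram matrices and orthonormalisation\<close>

lemma matrix_vector_component_product:
  fixes B :: "real^'n^'m"
  shows "(B *v x) $ i * (B *v x) $ j = (\<Sum>k\<in>UNIV. \<Sum>l\<in>UNIV. (B $ i $ k * B $ j $ l) * (x $ k * x $ l))"
  by (simp add: matrix_vector_mult_def sum_product mult_ac)

context
  fixes f :: "real \<Rightarrow> real^'p"
  assumes integrable_prod: "\<And>i j. integrable unit_interval_measure (\<lambda>x. f x $ i * f x $ j)"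
begin

lemma integrable_prod_matrix_image:
  "integrable unit_interval_measure (\<lambda>x. (B *v f x) $ i * (B *v f x) $ j)"
  unfolding matrix_vector_component_product
  by (intro Bochner_Integration.integrable_sum integrable_mult_right integrable_prod)

lemma gram_matrix_matrix_image:
  "gram_matrix (\<lambda>x. B *v f x) = B ** gram_matrix f ** transpose B"
proof -
  have "gram_matrix (\<lambda>x. B *v f x) $ i $ j = (B ** gram_matrix f ** transpose B) $ i $ j" for i j
  proof -
    have "gram_matrix (\<lambda>x. B *v f x) $ i $ j =
        (\<Sum>k\<in>UNIV. \<Sum>l\<in>UNIV. (B $ i $ k * B $ j $ l) * gram_matrix f $ k $ l)"
      unfolding gram_matrix_def matrix_vector_component_product
      by (simp add: Bochner_Integration.integral_sum Bochner_Integration.integrable_sum integrable_prod)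
    also have "\<dots> = (B ** gram_matrix f ** transpose B) $ i $ j"
      by (subst sum.swap) (simp add: matrix_matrix_mult_def transpose_def sum_distrib_left mult_ac)
    finally show ?thesis .
  qed
  then show ?thesis
    by (simp add: vec_eq_iff)
qed

lemma gram_matrix_quadratic_form:
  "x \<bullet> (gram_matrix f *v x) = (LINT t|unit_interval_measure. (x \<bullet> f t)\<^sup>2)"
proof -
  have "(x \<bullet> f t)\<^sup>2 = (\<Sum>k\<in>UNIV. \<Sum>l\<in>UNIV. (x $ k * x $ l) * (f t $ k * f t $ l))" for t
    by (simp add: inner_vec_def power2_eq_square sum_product mult_ac)
  then have "(LINT t|unit_interval_measure. (x \<bullet> f t)\<^sup>2) =
      (\<Sum>k\<in>UNIV. \<Sum>l\<in>UNIV. (x $ k * x $ l) * gram_matrix f $ k $ l)"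
    by (simp add: gram_matrix_def Bochner_Integration.integral_sum
        Bochner_Integration.integrable_sum integrable_prod)
  also have "\<dots> = x \<bullet> (gram_matrix f *v x)"
    by (simp add: inner_vec_def matrix_vector_mult_def sum_distrib_left mult_ac)
  finally show ?thesis ..
qed

lemma gram_matrix_pos_def:
  assumes "invertible (gram_matrix f)"
  shows "pos_def (gram_matrix f)"
proof (rule pos_semidef_invertible_pos_def[OF _ _ assms])
  show "transpose (gram_matrix f) = gram_matrix f"
    by (simp add: gram_matrix_def transpose_def vec_eq_iff mult.commute)
  show "0 \<le> x \<bullet> (gram_matrix f *v x)" for x
    by (simp add: gram_matrix_quadratic_form)
qed

lemma orthonormal_L2_gram_matrix:
  assumes meas: "\<And>i. (\<lambda>x. f x $ i) \<in> borel_measurable unit_interval_measure"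
    and "gram_matrix f = mat 1"
  shows "orthonormal_L2 f"
  using assms integrable_prod[of i i for i]
  by (simp add: orthonormal_L2_def gram_matrix_def mat_def vec_eq_iff power2_eq_square)

end

lemma partition_of_unity_measurable:
  "partition_of_unity \<xi> \<Longrightarrow> (\<lambda>x. \<xi> x $ i) \<in> borel_measurable unit_interval_measure"
  by (auto simp: partition_of_unity_def intro: borel_measurable_integrable)

lemma partition_of_unity_integrable_prod:
  fixes \<xi> :: "real \<Rightarrow> real^'p"
  assumes \<xi>: "partition_of_unity \<xi>"
  shows "integrable unit_interval_measure (\<lambda>x. \<xi> x $ i * \<xi> x $ j)"
proof (rule Bochner_Integration.integrable_bound)
  show "integrable unit_interval_measure (\<lambda>x. \<xi> x $ i)"
    using \<xi> by (simp add: partition_of_unity_def)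
  show "(\<lambda>x. \<xi> x $ i * \<xi> x $ j) \<in> borel_measurable unit_interval_measure"
    by (intro borel_measurable_times partition_of_unity_measurable \<xi>)
  have "\<xi> x $ j \<le> 1" if "x \<in> {0..1}" for x
    using member_le_sum[of j UNIV "\<lambda>j. \<xi> x $ j"] \<xi> that by (auto simp: partition_of_unity_def)
  then show "AE x in unit_interval_measure. norm (\<xi> x $ i * \<xi> x $ j) \<le> norm (\<xi> x $ i)"
    using \<xi> by (intro AE_I2) (auto simp: partition_of_unity_def abs_mult intro!: mult_left_le)
qed

lemma s_vec_component [simp]: "s_vec $ i = 1"
  by (simp add: s_vec_def axis_def)

lemma inner_s_vec: "x \<bullet> s_vec = (\<Sum>i\<in>UNIV. x $ i)"
  by (simp add: inner_vec_def)

text \<open>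
  Coordinate \<open>i\<close> is \<open>\<integral> \<xi>\<^sub>i (\<Sum>\<^sub>j \<xi>\<^sub>j) = \<integral> \<xi>\<^sub>i\<close>.
\<close>

lemma gram_matrix_mult_s_vec:
  fixes \<xi> :: "real \<Rightarrow> real^'p"
  assumes \<xi>: "partition_of_unity \<xi>"
  shows "gram_matrix \<xi> *v s_vec = (1 / real CARD('p)) *\<^sub>R s_vec"
proof -
  have "(gram_matrix \<xi> *v s_vec) $ i = 1 / real CARD('p)" for i
  proof -
    have "(gram_matrix \<xi> *v s_vec) $ i =
        (LINT x|unit_interval_measure. (\<Sum>j\<in>UNIV. \<xi> x $ i * \<xi> x $ j))"
      by (simp add: matrix_vector_mult_def gram_matrix_def Bochner_Integration.integral_sum
          partition_of_unity_integrable_prod[OF \<xi>])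
    also have "\<dots> = (LINT x|unit_interval_measure. \<xi> x $ i)"
      using \<xi> by (intro Bochner_Integration.integral_cong)
        (auto simp: partition_of_unity_def simp flip: sum_distrib_left)
    finally show ?thesis
      using \<xi> by (simp add: partition_of_unity_def)
  qed
  then show ?thesis
    by (simp add: vec_eq_iff)
qed

lemma outer_mult_vector: "outer x y *v z = (y \<bullet> z) *\<^sub>R x"
  by (simp add: outer_def matrix_vector_mult_def inner_vec_def vec_eq_iff sum_distrib_left mult_ac)

text \<open>
  When the coordinates of \<open>x\<close> sum to \<open>1\<close>, the coordinates of \<open>H x\<close> are \<open>1\<close> at \<open>i1\<close> and
  \<open>x\<^sub>i - x\<^sub>i\<^sub>1\<close> elsewhere: \<open>H\<close> turns a partition of unity into the constant function together with
  functions of mean zero.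
\<close>

lemma H_mat_mult_vector:
  "H_mat i1 *v x = x + (x \<bullet> s_vec) *\<^sub>R axis i1 1 - (x $ i1) *\<^sub>R s_vec"
  by (simp add: H_mat_def matrix_vector_mult_diff_rdistrib matrix_vector_mult_add_rdistrib
      outer_mult_vector inner_axis' inner_commute[of s_vec])

lemma H_mat_mult_s_vec:
  "H_mat i1 *v (s_vec :: real^'p) = real CARD('p) *\<^sub>R axis i1 1"
  by (simp add: H_mat_mult_vector inner_s_vec)

lemma inner_transpose_mult: "(transpose A *v x) \<bullet> y = x \<bullet> (A *v (y :: real^'n))"
  by (simp add: dot_lmul_matrix)

lemma transpose_H_mat_mult_axis: "transpose (H_mat i1) *v axis i1 1 = s_vec"
proof -
  have "(transpose (H_mat i1) *v axis i1 1) \<bullet> x = s_vec \<bullet> x" for x :: "real^'a"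
    unfolding inner_transpose_mult H_mat_mult_vector
    by (simp add: inner_axis' inner_commute[of s_vec])
  then show ?thesis
    using vector_eq_rdot by blast
qed

lemma doubly_stochastic_fixes_s_vec:
  assumes "doubly_stochastic M"
  shows "M *v s_vec = s_vec" "transpose M *v s_vec = s_vec"
proof -
  show "M *v s_vec = s_vec"
    using assms by (simp add: doubly_stochastic_def matrix_vector_mult_def vec_eq_iff)
  have "(transpose M *v s_vec) $ i = s_vec $ i" for i
    unfolding matrix_vector_mult_def transpose_def using assms by (simp add: doubly_stochastic_def)
  then show "transpose M *v s_vec = s_vec"
    unfolding vec_eq_iff by blast
qed

lemma doubly_stochastic_form_nonneg:
  assumes "doubly_stochastic M" "\<And>i. 0 \<le> x $ i" "\<And>i. 0 \<le> y $ i"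
  shows "0 \<le> x \<bullet> (M *v y)"
  using assms by (auto simp: doubly_stochastic_def inner_vec_def matrix_vector_mult_def
      intro!: sum_nonneg mult_nonneg_nonneg)

text \<open>
  Both hypotheses on \<open>L\<close> can be read backwards: \<open>p L\<^sup>-\<^sup>1 e = s\<close> and \<open>L\<^sup>-\<^sup>T s = e\<close>. Hence \<open>p L\<^sup>-\<^sup>T M L\<^sup>-\<^sup>1\<close>
  takes \<open>e\<close> to \<open>s\<close>, keeps it at \<open>s\<close>, and returns it to \<open>e\<close>.
\<close>

lemma conjugate_fixes_axis:
  fixes L M :: "real^'p^'p"
  assumes L: "invertible L" "L *v s_vec = real CARD('p) *\<^sub>R e" "transpose L *v e = s_vec"
    and M: "M *v s_vec = s_vec"
  shows "(real CARD('p) *\<^sub>R (transpose (matrix_inv L) ** M ** matrix_inv L)) *v e = e"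
proof -
  let ?K = "matrix_inv L"
  note inv = matrix_inv_mult[OF L(1)]
  have "real CARD('p) *\<^sub>R (?K *v e) = ?K *v (L *v s_vec)"
    by (simp add: L(2) matrix_vector_mult_scaleR)
  also have "\<dots> = s_vec"
    by (simp add: matrix_vector_mul_assoc inv)
  finally have K: "real CARD('p) *\<^sub>R (?K *v e) = s_vec" .
  have "(real CARD('p) *\<^sub>R (transpose ?K ** M ** ?K)) *v e
      = transpose ?K *v (M *v (real CARD('p) *\<^sub>R (?K *v e)))"
    by (simp only: matrix_vector_mult_scaleR flip: scaleR_matrix_vector_assoc matrix_vector_mul_assoc)
  also have "\<dots> = transpose ?K *v (transpose L *v e)"
    by (simp only: K M L(3))
  also have "\<dots> = transpose (L ** ?K) *v e"
    by (simp add: matrix_vector_mul_assoc matrix_transpose_mul del: transpose_matrix_vector)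
  finally show ?thesis
    by (simp add: inv transpose_mat)
qed

lemma transposed_conjugate:
  fixes K M :: "real^'p^'p"
  shows "transpose (r *\<^sub>R (transpose K ** M ** K)) = r *\<^sub>R (transpose K ** transpose M ** K)"
  by (simp add: transpose_scalar matrix_transpose_mul matrix_mul_assoc)

text \<open>
  The witness is \<open>A = p L\<^sup>-\<^sup>T M L\<^sup>-\<^sup>1\<close>, the matrix of the form \<open>p M\<close> in the coordinates \<open>L \<xi>\<close>. The
  constraint on \<open>A\<^sup>T\<close> is the constraint on \<open>A\<close> for \<open>M\<^sup>T\<close> in place of \<open>M\<close>.
\<close>

lemma form_in_C_set:
  fixes \<xi> :: "real \<Rightarrow> real^'p" and L M :: "real^'p^'p"
  assumes \<xi>: "partition_of_unity \<xi>" and M: "doubly_stochastic M" and L: "invertible L"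
    "L *v s_vec = real CARD('p) *\<^sub>R axis i1 1" "transpose L *v axis i1 1 = s_vec"
  shows "(\<lambda>u v. real CARD('p) * (\<xi> u \<bullet> (M *v \<xi> v))) \<in> C_set i1 (\<lambda>t. L *v \<xi> t)"
proof -
  let ?K = "matrix_inv L"
  define A where "A = real CARD('p) *\<^sub>R (transpose ?K ** M ** ?K)"
  have form: "(L *v x) \<bullet> (A *v (L *v y)) = real CARD('p) * (x \<bullet> (M *v y))" for x y
  proof -
    have "A *v (L *v y) = real CARD('p) *\<^sub>R (transpose ?K *v (M *v ((?K ** L) *v y)))"
      unfolding A_def
      by (simp only: flip: scaleR_matrix_vector_assoc matrix_vector_mul_assoc)
    then have "(L *v x) \<bullet> (A *v (L *v y)) = real CARD('p) * ((L *v x) \<bullet> (transpose ?K *v (M *v y)))"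
      by (simp add: matrix_inv_mult[OF L(1)] del: transpose_matrix_vector)
    also have "\<dots> = real CARD('p) * (((?K ** L) *v x) \<bullet> (M *v y))"
      by (metis inner_commute inner_transpose_mult matrix_vector_mul_assoc)
    finally show ?thesis
      by (simp add: matrix_inv_mult[OF L(1)])
  qed
  have "A *v axis i1 1 = axis i1 1" "transpose A *v axis i1 1 = axis i1 1"
    unfolding A_def transposed_conjugate
    by (intro conjugate_fixes_axis L doubly_stochastic_fixes_s_vec M)+
  moreover have "0 \<le> (L *v \<xi> u) \<bullet> (A *v (L *v \<xi> v))" if "u \<in> {0..1}" "v \<in> {0..1}" for u v
    unfolding form using \<xi> that
    by (intro mult_nonneg_nonneg doubly_stochastic_form_nonneg[OF M])
      (auto simp: partition_of_unity_def)
  ultimately have "A \<in> A_set i1 (\<lambda>t. L *v \<xi> t)"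
    by (simp add: A_set_def)
  then show ?thesis
    unfolding C_set_def by (auto simp: form intro!: bexI[of _ A])
qed

text \<open>
  \<open>S\<close> is the Gram matrix of \<open>H \<xi>\<close>, whose \<open>i1\<close> coordinate is the constant \<open>1\<close> and whose other
  coordinates have mean zero. So \<open>S\<close> fixes \<open>e\<^sub>1\<close>, and therefore \<open>S\<^sup>-\<^sup>1\<^sup>/\<^sup>2\<close> fixes it too: whitening
  does not disturb the constant coordinate, and the two identities relating \<open>H\<close>, \<open>s\<close> and \<open>e\<^sub>1\<close> are
  inherited by \<open>L = S\<^sup>-\<^sup>1\<^sup>/\<^sup>2 H\<close>.
\<close>

lemma whitened_partition_of_unity:
  fixes \<xi> :: "real \<Rightarrow> real^'p" and i1 :: 'p
  assumes \<xi>: "partition_of_unity \<xi>"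
  defines "S \<equiv> H_mat i1 ** gram_matrix \<xi> ** transpose (H_mat i1)"
  defines "L \<equiv> inv_sqrt S ** H_mat i1"
  assumes S: "invertible S"
  shows "orthonormal_L2 (\<lambda>t. L *v \<xi> t)" "invertible L"
    "L *v s_vec = real CARD('p) *\<^sub>R axis i1 1" "transpose L *v axis i1 1 = s_vec"
proof -
  note int = partition_of_unity_integrable_prod[OF \<xi>]
  let ?H = "H_mat i1" and ?e = "axis i1 1 :: real^'p" and ?R = "inv_sqrt S"
  have S_gram: "S = gram_matrix (\<lambda>t. ?H *v \<xi> t)"
    unfolding S_def using int by (simp add: gram_matrix_matrix_image)
  have "pos_def S"
    using S unfolding S_gram by (intro gram_matrix_pos_def integrable_prod_matrix_image int)
  note R = inv_sqrt_square[OF \<open>pos_def S\<close> S]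
  have R_sym: "transpose ?R = ?R"
    using R(1) by (simp add: pos_def_def)
  \<comment> \<open>the chain \<open>H\<^sup>T e\<^sub>1 = s\<close>, \<open>\<Gamma> s = s / p\<close>, \<open>H s = p e\<^sub>1\<close>\<close>
  have "S *v ?e = ?H *v (gram_matrix \<xi> *v (transpose ?H *v ?e))"
    unfolding S_def by (simp add: matrix_vector_mul_assoc matrix_mul_assoc del: transpose_matrix_vector)
  also have "\<dots> = ?e"
    by (simp add: transpose_H_mat_mult_axis gram_matrix_mult_s_vec[OF \<xi>] matrix_vector_mult_scaleR
        H_mat_mult_s_vec del: transpose_matrix_vector)
  finally have R_e: "?R *v ?e = ?e"
    by (rule inv_sqrt_fixes[OF \<open>pos_def S\<close> S])
  show "L *v s_vec = real CARD('p) *\<^sub>R ?e"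
    unfolding L_def
    by (simp add: H_mat_mult_s_vec matrix_vector_mult_scaleR R_e flip: matrix_vector_mul_assoc)
  show "transpose L *v ?e = s_vec"
    unfolding L_def
    by (simp add: matrix_transpose_mul R_sym R_e transpose_H_mat_mult_axis
        flip: matrix_vector_mul_assoc del: transpose_matrix_vector)
  have "L ** gram_matrix \<xi> ** transpose L = ?R ** S ** ?R"
    unfolding L_def S_def by (simp add: matrix_transpose_mul R_sym[unfolded S_def] matrix_mul_assoc)
  then have gram: "L ** gram_matrix \<xi> ** transpose L = mat 1"
    using inv_sqrt_whitens[OF \<open>pos_def S\<close> S] by simp
  then have "L ** (gram_matrix \<xi> ** transpose L) = mat 1"
    by (simp add: matrix_mul_assoc)
  then show "invertible L"
    using invertible_right_inverse by blast
  have "(\<lambda>t. (L *v \<xi> t) $ i) \<in> borel_measurable unit_interval_measure" for i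
    unfolding matrix_vector_mult_def
    using partition_of_unity_measurable[OF \<xi>] by simp
  then show "orthonormal_L2 (\<lambda>t. L *v \<xi> t)"
    by (intro orthonormal_L2_gram_matrix integrable_prod_matrix_image int)
      (simp_all add: gram_matrix_matrix_image[OF int] gram)
qed

section \<open>The law with density c\<close>

lemma AE_lborel_fst_snd:
  assumes "AE x in lborel. P (x :: real)"
  shows "AE z in (lborel :: (real \<times> real) measure). P (fst z) \<and> P (snd z)"
proof -
  obtain N where N: "{x. \<not> P x} \<subseteq> N" "N \<in> null_sets lborel"
    using assms by (auto simp: eventually_ae_filter)
  have "N \<times> UNIV \<union> UNIV \<times> N \<in> null_sets (lborel \<Otimes>\<^sub>M lborel)"
    using N(2) by (intro null_sets.Un lborel.times_in_null_sets1 lborel.times_in_null_sets2) auto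
  then show ?thesis
    using N(1) by (intro AE_I'[of "N \<times> UNIV \<union> UNIV \<times> N"]) (auto simp: lborel_prod)
qed

lemma nn_integral_lborel_fst_times_snd:
  fixes f g :: "real \<Rightarrow> ennreal"
  assumes [measurable]: "f \<in> borel_measurable borel" "g \<in> borel_measurable borel"
  shows "(\<integral>\<^sup>+z. f (fst z) * g (snd z) \<partial>lborel) = (\<integral>\<^sup>+x. f x \<partial>lborel) * (\<integral>\<^sup>+y. g y \<partial>lborel)"
proof -
  have "(\<integral>\<^sup>+z. f (fst z) * g (snd z) \<partial>lborel) = (\<integral>\<^sup>+z. f (fst z) * g (snd z) \<partial>(lborel \<Otimes>\<^sub>M lborel))"
    by (simp add: lborel_prod)
  also have "\<dots> = (\<integral>\<^sup>+x. \<integral>\<^sup>+y. f x * g y \<partial>lborel \<partial>lborel)"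
    by (subst lborel.nn_integral_fst[symmetric]) simp_all
  finally show ?thesis
    by (simp add: nn_integral_cmult nn_integral_multc)
qed

text \<open>
  Lebesgue measure on the plane is larger than the product of the Lebesgue measures on the lines,
  whereas \<open>lborel\<close> is compatible with products. Integrals over the square are therefore computed
  with Borel versions of the \<open>\<xi>\<^sub>i\<close>, extended by zero outside the unit interval.
\<close>

lemma lebesgue_on_borel_version:
  fixes f :: "real \<Rightarrow> real"
  assumes f: "f \<in> borel_measurable (lebesgue_on {0..1})" and nonneg: "\<And>x. x \<in> {0..1} \<Longrightarrow> 0 \<le> f x"
  obtains g where "g \<in> borel_measurable borel" "\<And>x. 0 \<le> g x"
    "AE x in lborel. g x = indicator {0..1} x * f x"
proof -
  have "(\<lambda>x. indicator {0..1} x * f x) \<in> borel_measurable lebesgue"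
    using f by (simp add: borel_measurable_restrict_space_iff)
  then obtain h where h: "h \<in> borel_measurable lborel" "AE x in lborel. indicator {0..1} x * f x = h x"
    using completion_ex_borel_measurable_real by blast
  show thesis
  proof
    show "(\<lambda>x. max 0 (h x)) \<in> borel_measurable borel"
      using h(1) by simp
    show "AE x in lborel. max 0 (h x) = indicator {0..1} x * f x"
      using h(2)
    proof eventually_elim
      case (elim x)
      then show ?case
        using nonneg[of x] by (cases "x \<in> {0..1}") auto
    qed
  qed simp
qed

text \<open>
  The law is the measure with density \<open>c\<close>, transported to the Borel sets. As \<open>c\<close> is a finite sum of
  products, the mass of a rectangle \<open>A \<times> B\<close> factors by Tonelli into \<open>\<Sum> p M\<^sub>i\<^sub>j G\<^sub>i(A) G\<^sub>j(B)\<close>,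
  where \<open>G\<^sub>i\<close> is the measure with density \<open>\<xi>\<^sub>i\<close>. The factor \<open>p\<close> cancels the mass \<open>1 / p\<close> of each
  \<open>G\<^sub>i\<close>, the row and column sums of \<open>M\<close> remove \<open>M\<close>, and the \<open>G\<^sub>i\<close> add up to the uniform law since
  the \<open>\<xi>\<^sub>i\<close> add up to \<open>1\<close>.
\<close>

lemma copula_density_of_partition:
  fixes \<xi> :: "real \<Rightarrow> real^'p" and M :: "real^'p^'p"
  assumes \<xi>: "partition_of_unity \<xi>" and M: "doubly_stochastic M"
  shows "copula_density (\<lambda>u v. real CARD('p) * (\<xi> u \<bullet> (M *v \<xi> v)))"
proof -
  define p where "p = real CARD('p)"
  have p: "0 < p" by (simp add: p_def)
  define c where "c = (\<lambda>u v. p * (\<xi> u \<bullet> (M *v \<xi> v)))"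
  have M_nonneg: "0 \<le> M $ i $ j" for i j
    using M by (simp add: doubly_stochastic_def)
  have \<xi>_nonneg: "0 \<le> \<xi> x $ i" if "x \<in> {0..1}" for x i
    using \<xi> that by (simp add: partition_of_unity_def)
  have \<xi>_int: "integrable (lebesgue_on {0..1}) (\<lambda>x. \<xi> x $ i)" for i
    using \<xi> by (simp add: partition_of_unity_def)
  have c_sum: "c u v = (\<Sum>i\<in>UNIV. \<Sum>j\<in>UNIV. p * M $ i $ j * (\<xi> u $ i * \<xi> v $ j))" for u v
    by (simp add: c_def inner_vec_def matrix_vector_mult_def sum_distrib_left mult_ac)
  have c_nonneg: "0 \<le> c u v" if "u \<in> {0..1}" "v \<in> {0..1}" for u v
    unfolding c_sum using p M_nonneg \<xi>_nonneg that by (intro sum_nonneg mult_nonneg_nonneg) auto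

  have "\<exists>g. g \<in> borel_measurable borel \<and> (\<forall>x. 0 \<le> g x) \<and>
      (AE x in lborel. g x = indicator {0..1} x * \<xi> x $ i)" for i
    using lebesgue_on_borel_version[OF borel_measurable_integrable[OF \<xi>_int[of i]] \<xi>_nonneg]
    by blast
  then obtain g where g_meas [measurable]: "\<And>i. g i \<in> borel_measurable borel"
    and g_nonneg: "\<And>i x. 0 \<le> g i x"
    and g_AE: "\<And>i. AE x in lborel. g i x = indicator {0..1} x * \<xi> x $ i"
    by metis
  have g_AE_all: "AE x in lborel. \<forall>i. g i x = indicator {0..1} x * \<xi> x $ i"
    using g_AE by (simp add: AE_all_countable)

  define G where "G = (\<lambda>i A. \<integral>\<^sup>+x. ennreal (g i x) * indicator A x \<partial>lborel)"
  have G_UNIV: "G i UNIV = ennreal (1 / p)" for i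
  proof -
    have "G i UNIV = (\<integral>\<^sup>+x. ennreal (\<xi> x $ i) * indicator {0..1} x \<partial>lborel)"
      unfolding G_def using g_AE[of i]
      by (intro nn_integral_cong_AE) (auto elim!: eventually_mono split: split_indicator)
    also have "\<dots> = (\<integral>\<^sup>+x. ennreal (\<xi> x $ i) \<partial>lebesgue_on {0..1})"
      by (simp add: nn_integral_restrict_space nn_integral_completion)
    also have "\<dots> = ennreal (1 / p)"
      using \<xi> \<xi>_nonneg
      by (subst nn_integral_eq_integral[OF \<xi>_int]) (auto simp: partition_of_unity_def p_def)
    finally show ?thesis .
  qed
  have G_sum: "(\<Sum>i\<in>UNIV. G i A) = emeasure lborel ({0..1} \<inter> A)"
    if [measurable]: "A \<in> sets borel" for A
  proof -
    have "(\<Sum>i\<in>UNIV. G i A) = (\<integral>\<^sup>+x. (\<Sum>i\<in>UNIV. ennreal (g i x) * indicator A x) \<partial>lborel)"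
      unfolding G_def by (subst nn_integral_sum) auto
    also have "\<dots> = (\<integral>\<^sup>+x. indicator ({0..1} \<inter> A) x \<partial>lborel)"
      using g_AE_all
    proof (intro nn_integral_cong_AE, eventually_elim)
      case (elim x)
      have "(\<Sum>i\<in>UNIV. ennreal (g i x) * indicator A x) = ennreal (\<Sum>i\<in>UNIV. g i x) * indicator A x"
        using g_nonneg by (simp add: sum_distrib_right sum_ennreal)
      also have "(\<Sum>i\<in>UNIV. g i x) = indicator {0..1} x"
        using elim \<xi> by (auto simp: partition_of_unity_def simp flip: sum_distrib_left
            split: split_indicator)
      finally show ?case
        by (auto split: split_indicator)
    qed
    finally show ?thesis
      by simp
  qed

  \<comment> \<open>a Borel version of \<open>c\<close>, extended by zero\<close>
  define c' where "c' = (\<lambda>z. \<Sum>i\<in>UNIV. \<Sum>j\<in>UNIV. p * M $ i $ j * (g i (fst z) * g j (snd z)))"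
  have c'_meas [measurable]: "c' \<in> borel_measurable borel"
    unfolding c'_def borel_prod[symmetric] by measurable
  have c'_AE: "AE z in lborel. c' z = indicator ({0..1} \<times> {0..1}) z * c (fst z) (snd z)"
    using AE_lborel_fst_snd[OF g_AE_all]
  proof eventually_elim
    case (elim z)
    then show ?case
      by (cases z) (auto simp: c'_def c_sum split: split_indicator)
  qed

  have c_meas: "(\<lambda>z. c (fst z) (snd z)) \<in> borel_measurable (lebesgue_on ({0..1} \<times> {0..1}))"
  proof -
    have "(\<lambda>z. indicator ({0..1} \<times> {0..1}) z * c (fst z) (snd z)) \<in> borel_measurable lebesgue"
      by (rule borel_measurable_AE[OF _ AE_completion[OF c'_AE]]) (simp add: measurable_completion)
    then show ?thesis
      by (subst borel_measurable_restrict_space_iff) (auto simp: lborelD_Collect borel_Times)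
  qed

  define \<mu> where
    "\<mu> = distr (density (lebesgue_on ({0..1} \<times> {0..1})) (\<lambda>z. ennreal (c (fst z) (snd z)))) borel id"
  have sets_\<mu>: "sets \<mu> = sets borel"
    by (simp add: \<mu>_def)
  have id_meas: "id \<in> measurable (lebesgue_on ({0..1} \<times> {0..1})) (borel :: (real \<times> real) measure)"
    by (intro measurable_restrict_space1 measurable_completion) simp
  have emeasure_\<mu>: "emeasure \<mu> B =
      (\<integral>\<^sup>+z\<in>B. ennreal (c (fst z) (snd z)) \<partial>lebesgue_on ({0..1} \<times> {0..1}))"
    if B: "B \<in> sets borel" for B
  proof -
    have "id -` B \<inter> space (lebesgue_on ({0..1} \<times> {0..1})) \<in> sets (lebesgue_on ({0..1} \<times> {0..1}))"
      using id_meas B by (rule measurable_sets)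
    then have "emeasure \<mu> B = (\<integral>\<^sup>+z. ennreal (c (fst z) (snd z)) *
        indicator (id -` B \<inter> space (lebesgue_on ({0..1} \<times> {0..1}))) z \<partial>lebesgue_on ({0..1} \<times> {0..1}))"
      unfolding \<mu>_def using B id_meas c_meas
      by (subst emeasure_distr) (auto simp: emeasure_density)
    also have "\<dots> = (\<integral>\<^sup>+z\<in>B. ennreal (c (fst z) (snd z)) \<partial>lebesgue_on ({0..1} \<times> {0..1}))"
      by (intro nn_integral_cong) (auto split: split_indicator)
    finally show ?thesis .
  qed
  have rectangle: "emeasure \<mu> (A \<times> B) = (\<Sum>i\<in>UNIV. \<Sum>j\<in>UNIV. ennreal (p * M $ i $ j) * (G i A * G j B))"
    if [measurable]: "A \<in> sets borel" "B \<in> sets borel" for A B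
  proof -
    have [measurable]: "A \<times> B \<in> sets borel"
      by (intro borel_Times) measurable
    have product: "(\<integral>\<^sup>+z. (ennreal (g i (fst z)) * indicator A (fst z)) *
        (ennreal (g j (snd z)) * indicator B (snd z)) \<partial>lborel) = G i A * G j B" for i j
      unfolding G_def
      by (rule nn_integral_lborel_fst_times_snd[where f = "\<lambda>x. ennreal (g i x) * indicator A x"
            and g = "\<lambda>x. ennreal (g j x) * indicator B x"]) measurable
    have "emeasure \<mu> (A \<times> B) = (\<integral>\<^sup>+z. ennreal (c (fst z) (snd z)) * indicator (A \<times> B) z *
        indicator ({0..1} \<times> {0..1}) z \<partial>lborel)"
      by (simp add: emeasure_\<mu> nn_integral_restrict_space nn_integral_completion borel_Times)
    also have "\<dots> = (\<integral>\<^sup>+z. ennreal (c' z) * indicator (A \<times> B) z \<partial>lborel)"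
      using c'_AE
    proof (intro nn_integral_cong_AE, eventually_elim)
      case (elim z)
      then show ?case
        by (cases "z \<in> {0..1} \<times> {0..1}") (simp_all add: mult_ac)
    qed
    also have "\<dots> = (\<integral>\<^sup>+z. (\<Sum>i\<in>UNIV. \<Sum>j\<in>UNIV. ennreal (p * M $ i $ j) *
        ((ennreal (g i (fst z)) * indicator A (fst z)) * (ennreal (g j (snd z)) * indicator B (snd z)))) \<partial>lborel)"
    proof (intro nn_integral_cong)
      fix z :: "real \<times> real"
      have "ennreal (c' z) = (\<Sum>i\<in>UNIV. \<Sum>j\<in>UNIV. ennreal (p * M $ i $ j) *
          (ennreal (g i (fst z)) * ennreal (g j (snd z))))"
        using p M_nonneg g_nonneg
        by (simp add: c'_def sum_nonneg ennreal_mult flip: sum_ennreal)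
      then show "ennreal (c' z) * indicator (A \<times> B) z = (\<Sum>i\<in>UNIV. \<Sum>j\<in>UNIV. ennreal (p * M $ i $ j) *
        ((ennreal (g i (fst z)) * indicator A (fst z)) * (ennreal (g j (snd z)) * indicator B (snd z))))"
        by (cases z) (simp add: indicator_times sum_distrib_right mult_ac)
    qed
    also have "\<dots> = (\<Sum>i\<in>UNIV. \<Sum>j\<in>UNIV. ennreal (p * M $ i $ j) * (G i A * G j B))"
      by (simp add: nn_integral_sum nn_integral_cmult product borel_prod[symmetric])
    finally show ?thesis .
  qed
  have collapse: "ennreal (p * m) * (ennreal (1 / p) * a) = ennreal m * a"
    "ennreal (p * m) * (a * ennreal (1 / p)) = ennreal m * a" if "0 \<le> m" for m a
  proof -
    have "ennreal (p * m) * ennreal (1 / p) = ennreal m"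
      using p that by (simp flip: ennreal_mult)
    then show "ennreal (p * m) * (ennreal (1 / p) * a) = ennreal m * a"
      by (simp flip: mult.assoc)
    then show "ennreal (p * m) * (a * ennreal (1 / p)) = ennreal m * a"
      by (simp only: mult.commute[of a])
  qed
  have fst_margin: "emeasure \<mu> (A \<times> UNIV) = emeasure lborel ({0..1} \<inter> A)"
    if A: "A \<in> sets borel" for A
  proof -
    have "emeasure \<mu> (A \<times> UNIV) = (\<Sum>i\<in>UNIV. \<Sum>j\<in>UNIV. ennreal (M $ i $ j) * G i A)"
      using A M_nonneg by (simp add: rectangle G_UNIV collapse)
    also have "\<dots> = (\<Sum>i\<in>UNIV. ennreal (\<Sum>j\<in>UNIV. M $ i $ j) * G i A)"
      using M_nonneg by (simp add: sum_distrib_right flip: sum_ennreal)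
    also have "\<dots> = (\<Sum>i\<in>UNIV. G i A)"
      using M by (simp add: doubly_stochastic_def)
    finally show ?thesis
      using A by (simp add: G_sum)
  qed
  have snd_margin: "emeasure \<mu> (UNIV \<times> A) = emeasure lborel ({0..1} \<inter> A)"
    if A: "A \<in> sets borel" for A
  proof -
    have "emeasure \<mu> (UNIV \<times> A) = (\<Sum>i\<in>UNIV. \<Sum>j\<in>UNIV. ennreal (M $ i $ j) * G j A)"
      using A M_nonneg by (simp add: rectangle G_UNIV collapse)
    also have "\<dots> = (\<Sum>j\<in>UNIV. \<Sum>i\<in>UNIV. ennreal (M $ i $ j) * G j A)"
      by (rule sum.swap)
    also have "\<dots> = (\<Sum>j\<in>UNIV. ennreal (\<Sum>i\<in>UNIV. M $ i $ j) * G j A)"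
      using M_nonneg by (simp add: sum_distrib_right flip: sum_ennreal)
    also have "\<dots> = (\<Sum>j\<in>UNIV. G j A)"
      using M by (simp add: doubly_stochastic_def)
    finally show ?thesis
      using A by (simp add: G_sum)
  qed
  have "copula_law \<mu>"
    unfolding copula_law_def
  proof (intro conjI sets_\<mu>)
    have space_\<mu>: "space \<mu> = UNIV"
      by (simp add: \<mu>_def)
    show "prob_space \<mu>"
      using fst_margin[of UNIV] by (intro prob_spaceI) (simp add: space_\<mu>)
    have [measurable_cong]: "sets \<mu> = sets ((borel :: real measure) \<Otimes>\<^sub>M (borel :: real measure))"
      by (simp only: sets_\<mu> borel_prod)
    show "distr \<mu> borel fst = uniform_measure lborel {0..1}"
    proof (rule measure_eqI)
      fix A :: "real set" assume "A \<in> sets (distr \<mu> borel fst)"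
      then show "emeasure (distr \<mu> borel fst) A = emeasure (uniform_measure lborel {0..1}) A"
        using fst_margin[of A] by (simp add: emeasure_distr fst_vimage_eq_Times space_\<mu> divide_ennreal_def)
    qed simp
    show "distr \<mu> borel snd = uniform_measure lborel {0..1}"
    proof (rule measure_eqI)
      fix A :: "real set" assume "A \<in> sets (distr \<mu> borel snd)"
      then show "emeasure (distr \<mu> borel snd) A = emeasure (uniform_measure lborel {0..1}) A"
        using snd_margin[of A] by (simp add: emeasure_distr snd_vimage_eq_Times space_\<mu> divide_ennreal_def)
    qed simp
  qed
  then have "copula_density c"
    unfolding copula_density_def using c_nonneg c_meas emeasure_\<mu> by blast
  then show ?thesis
    unfolding c_def p_def .
qed

section \<open>The copula density in the orthonormal basis\<close>

theorem proposition10: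
  fixes \<xi> :: "real \<Rightarrow> real^'p" and M :: "real^'p^'p" and i1 :: 'p
  defines "c \<equiv> (\<lambda>u v. real CARD('p) * (\<xi> u \<bullet> (M *v \<xi> v)))"
    and "S \<equiv> H_mat i1 ** gram_matrix \<xi> ** transpose (H_mat i1)"
  defines "\<phi> \<equiv> (\<lambda>t. inv_sqrt S *v (H_mat i1 *v \<xi> t))"
  assumes "2 \<le> CARD('p)" and "partition_of_unity \<xi>" and "doubly_stochastic M"
  shows "copula_density c \<and>
         (invertible S \<longrightarrow>
            orthonormal_L2 \<phi> \<and> (\<forall>t\<in>{0..1}. \<phi> t $ i1 = 1) \<and> c \<in> C_set i1 \<phi>)"
proof (intro conjI impI)
  show "copula_density c"
    unfolding c_def using assms(5,6) by (rule copula_density_of_partition)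
next
  assume S: "invertible S"
  define L where "L = inv_sqrt S ** H_mat i1"
  have \<phi>: "\<phi> = (\<lambda>t. L *v \<xi> t)"
    by (simp add: \<phi>_def L_def matrix_vector_mul_assoc)
  note L = whitened_partition_of_unity[OF assms(5) S[unfolded S_def], folded S_def, folded L_def]
  show "orthonormal_L2 \<phi>"
    unfolding \<phi> by (rule L(1))
  show "c \<in> C_set i1 \<phi>"
    unfolding \<phi> c_def using assms(5,6) L(2-4) by (rule form_in_C_set)
  show "\<forall>t\<in>{0..1}. \<phi> t $ i1 = 1"
  proof
    fix t :: real
    assume t: "t \<in> {0..1}"
    have "\<phi> t $ i1 = (transpose L *v axis i1 1) \<bullet> \<xi> t"
      unfolding inner_transpose_mult \<phi> by (simp add: inner_axis')
    also have "\<dots> = (\<Sum>i\<in>UNIV. \<xi> t $ i)"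
      by (simp only: L(4) inner_commute[of s_vec] inner_s_vec)
    finally show "\<phi> t $ i1 = 1"
      using assms(5) t by (simp add: partition_of_unity_def)
  qed
qed

end
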